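(* Let $q=3^d$ with $d$ odd, and consider the elliptic curve $E\colon y^2=x^3+x$ over $\mathbb{F}_q$. Then $\#E(\mathbb{F}_q)=q+1$.
   Context: $\#E(\mathbb{F}_q)$ counts all $\mathbb{F}_q$-rational points, including the point at infinity. *)

theory Defs
  imports Complex_Main "HOL-Library.Cardinality"
begin

text \<open>
  Weierstrass curves \<open>y^2 + a1 x y + a3 y = x^3 + a2 x^2 + a4 x + a6\<close>, in the usual
  numbering of coefficients (there is no \<open>a5\<close>). The quantities \<open>b2, b4, b6, b8\<close> and
  the discriminant are the standard ones (Silverman, The Arithmetic of Elliptic Curves,
  III.1); they are correct in every characteristic, including 2 and 3.
\<close>

datatype 'a weierstrass =
  Weierstrass (a1: 'a) (a2: 'a) (a3: 'a) (a4: 'a) (a6: 'a)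

definition b2 :: "'a::field weierstrass \<Rightarrow> 'a" where
  "b2 E = a1 E ^ 2 + 4 * a2 E"

definition b4 :: "'a::field weierstrass \<Rightarrow> 'a" where
  "b4 E = 2 * a4 E + a1 E * a3 E"

definition b6 :: "'a::field weierstrass \<Rightarrow> 'a" where
  "b6 E = a3 E ^ 2 + 4 * a6 E"

definition b8 :: "'a::field weierstrass \<Rightarrow> 'a" where
  "b8 E = a1 E ^ 2 * a6 E + 4 * a2 E * a6 E - a1 E * a3 E * a4 E
          + a2 E * a3 E ^ 2 - a4 E ^ 2"

definition discriminant :: "'a::field weierstrass \<Rightarrow> 'a" where
  "discriminant E = - (b2 E ^ 2 * b8 E) - 8 * b4 E ^ 3 - 27 * b6 E ^ 2
                    + 9 * b2 E * b4 E * b6 E"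

text \<open>
  A Weierstrass curve is smooth, also over the algebraic closure, iff its discriminant
  does not vanish.
\<close>

definition elliptic_curve :: "'a::field weierstrass \<Rightarrow> bool" where
  "elliptic_curve E \<longleftrightarrow> discriminant E \<noteq> 0"

definition on_affine_curve :: "'a::field weierstrass \<Rightarrow> 'a \<Rightarrow> 'a \<Rightarrow> bool" where
  "on_affine_curve E x y \<longleftrightarrow>
     y ^ 2 + a1 E * x * y + a3 E * y = x ^ 3 + a2 E * x ^ 2 + a4 E * x + a6 E"

text \<open>
  The projective closure meets the line at infinity in exactly one point, \<open>[0 : 1 : 0]\<close>,
  which is rational over every field of definition; it is \<open>Infinity\<close> below.
\<close>

datatype 'a point = Infinity | Affine 'a 'a

text \<open>
  The points of \<open>E\<close> that are rational over the field given by the type \<open>'a\<close>.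
\<close>

definition rational_points :: "'a::field weierstrass \<Rightarrow> 'a point set" where
  "rational_points E = insert Infinity {Affine x y | x y. on_affine_curve E x y}"

end

theory Submission
  imports Defs
begin

text \<open>
  In characteristic 3 the map \<open>x \<mapsto> x\<^sup>3 + x\<close> is additive, and its kernel is trivial because
  \<open>-1\<close> is not a square in a field with \<open>3 ^ d\<close> elements for odd \<open>d\<close>: if \<open>i\<^sup>2 = -1\<close> then
  \<open>i\<^sup>3 = -i\<close>, so \<open>i ^ (3 ^ d) = -i\<close>, against Fermat. Hence the map permutes the field, and
  every \<open>y\<close> is the ordinate of exactly one affine point.
\<close>

text \<open>Translation by 1 permutes the ring, so adding 1 to every element leaves the sum of all
  elements unchanged.\<close>

lemma of_nat_card_UNIV_eq_0: "of_nat CARD('a) = (0 :: 'a::{ring_1,finite})"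
proof -
  have "bij_betw (\<lambda>x::'a. x + 1) UNIV UNIV"
    by (rule bij_betw_byWitness[where f' = "\<lambda>x. x - 1"]) auto
  then have "(\<Sum>x\<in>UNIV. x + 1) = (\<Sum>x\<in>UNIV. x :: 'a)"
    by (rule sum.reindex_bij_betw)
  then show ?thesis
    by (simp add: sum.distrib)
qed

lemma three_eq_0:
  assumes "CARD('a::{field,finite}) = 3 ^ d"
  shows "(3 :: 'a) = 0"
  using of_nat_card_UNIV_eq_0[where 'a = 'a] by (simp add: assms)

text \<open>
  The library's \<open>finite_field_power_card_eq_same\<close> is stated for the class \<open>finite_field\<close>, and
  \<open>{field,finite}\<close> is not a subsort of it.
\<close>

lemma power_card_UNIV_eq_self:
  fixes x :: "'a::{field,finite}"
  shows "x ^ CARD('a) = x"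
proof (cases "x = 0")
  case False
  let ?P = "\<Prod>y\<in>UNIV - {0::'a}. y"
  \<comment> \<open>Multiplication by \<open>x\<close> only permutes the factors of
    \<open>?P\<close>, which is nonzero and can be cancelled.\<close>
  have "bij_betw ((*) x) (UNIV - {0}) (UNIV - {0})"
    by (rule bij_betw_byWitness[where f' = "\<lambda>y. y / x"]) (use False in auto)
  then have "(\<Prod>y\<in>UNIV - {0}. x * y) = ?P"
    by (rule prod.reindex_bij_betw)
  then have "x ^ (CARD('a) - 1) * ?P = ?P"
    by (simp add: prod.distrib card_Diff_singleton)
  moreover have "?P \<noteq> 0"
    by (simp add: prod_zero_iff)
  ultimately have "x ^ (CARD('a) - 1) = 1"
    by (simp only: mult_cancel_right1 mult_cancel_right2) blast
  then show ?thesis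
    using power_minus_mult[of "CARD('a)" x] by simp
qed simp

lemma minus_one_not_square:
  fixes x :: "'a::{field,finite}"
  assumes "odd d" and card: "CARD('a) = 3 ^ d"
  shows "x ^ 2 \<noteq> - 1"
proof
  assume sq: "x ^ 2 = - 1"
  have pow: "x ^ (3 ^ n) = (- 1) ^ n * x" for n
  proof (induction n)
    case (Suc n)
    have "x ^ (3 ^ Suc n) = ((- 1) ^ n * x) ^ 3"
      by (simp add: Suc power_mult mult.commute[of 3])
    also have "\<dots> = ((- 1) ^ n) ^ 3 * (x ^ 2 * x)"
      by (simp add: power_mult_distrib power3_eq_cube power2_eq_square)
    also have "\<dots> = (- 1) ^ Suc n * x"
      by (cases "even n") (simp_all add: sq)
    finally show ?case .
  qed simp
  have "x = x ^ CARD('a)"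
    by (rule power_card_UNIV_eq_self[symmetric])
  also have "\<dots> = - x"
    using pow[of d] \<open>odd d\<close> by (simp add: card)
  finally have "x + x = 0"
    by (metis ab_left_minus)
  \<comment> \<open>Both \<open>2 * x\<close> and \<open>3 * x\<close> vanish, hence so does their
    difference \<open>x\<close>.\<close>
  have "x = (x + x) + x"
    by (simp only: \<open>x + x = 0\<close> add_0_left)
  also have "\<dots> = 3 * x"
    by simp
  also have "\<dots> = 0"
    by (simp only: three_eq_0[OF card] mult_zero_left)
  finally have "x = 0" .
  then show False
    using sq by simp
qed

theorem proposition3p3:
  fixes q d :: nat
    and E :: "'a::{field,finite} weierstrass"
  assumes "odd d"
    and "q = 3 ^ d"
    and "CARD('a) = q"
    and "E = Weierstrass 0 0 0 1 0"
  shows "elliptic_curve E \<and> card (rational_points E) = q + 1"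
proof
  have three: "(3 :: 'a) = 0"
    using assms by (intro three_eq_0) simp
  \<comment> \<open>The discriminant is -64, split here to expose a multiple of 3.\<close>
  have "discriminant E = - 1 - 3 * 21"
    by (simp add: \<open>E = _\<close> discriminant_def b2_def b4_def b6_def b8_def)
  also have "\<dots> = - 1"
    by (simp only: three) simp
  finally show "elliptic_curve E"
    by (simp add: elliptic_curve_def)
  define f where "f x = x ^ 3 + x" for x :: 'a
  have "inj f"
  proof (rule injI)
    fix x y
    assume "f x = f y"
    \<comment> \<open>The cross terms of \<open>(x - y) ^ 3\<close> carry the factor 3, so the left
      side is \<open>f x - f y\<close> in characteristic 3.\<close>
    have "(x - y) * ((x - y) ^ 2 + 1) = f x - f y - 3 * (x * y * (x - y))"
      by (simp add: f_def power2_eq_square power3_eq_cube algebra_simps)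
    also have "\<dots> = 0"
      by (simp only: three \<open>f x = f y\<close>) simp
    finally have "x - y = 0 \<or> (x - y) ^ 2 = - 1"
      by (simp only: mult_eq_0_iff eq_neg_iff_add_eq_0)
    then show "x = y"
      using minus_one_not_square[of d "x - y"] assms by simp
  qed
  then have "surj f"
    by (rule finite_UNIV_inj_surj[OF finite])
  have "on_affine_curve E x y \<longleftrightarrow> x = inv f (y ^ 2)" for x y
  proof -
    have "on_affine_curve E x y \<longleftrightarrow> y ^ 2 = f x"
      by (simp add: \<open>E = _\<close> on_affine_curve_def f_def)
    then show ?thesis
      using \<open>inj f\<close> \<open>surj f\<close> by (metis inv_f_f surj_f_inv_f)
  qed
  then have "rational_points E = insert Infinity (range (\<lambda>y. Affine (inv f (y ^ 2)) y))"
    by (auto simp: rational_points_def)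
  moreover have "card (range (\<lambda>y. Affine (inv f (y ^ 2)) y)) = CARD('a)"
    by (rule card_image) (auto intro: injI)
  moreover have "Infinity \<notin> range (\<lambda>y. Affine (inv f (y ^ 2)) y)"
    by blast
  ultimately show "card (rational_points E) = q + 1"
    using \<open>CARD('a) = q\<close> by simp
qed

end
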